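(* Let $M,n\ge1$ and $N=Mn$. For $m=1,\dots,M$ and $i=1,\dots,n$ let $f_{mi}:\mathbb{R}^d\to\mathbb{R}$ be convex and $L_i$-smooth with $L_i>0$ (for each $m$ and $i$), let $L_{\max}=\max_i L_i$, $F_m=\sum_{j=1}^n f_{mj}$, and let $R:\mathbb{R}^d\to\mathbb{R}\cup\{+\infty\}$ be proper, closed and $\mu$-strongly convex with $\mu>0$. Let $x_\ast$ be the minimizer of $\frac1N\sum_{m=1}^M F_m(x)+R(x)$. If $0<\gamma\le\frac1{L_{\max}}$, then for every $T\ge 0$ the iterates of FedRR (or FedSO) with stepsize $\gamma$ started at $x_0\in\mathbb{R}^d$ satisfy $$\mathbb{E}\|x_T-x_\ast\|^2\le(1+2\gamma\mu n)^{-T}\|x_0-x_\ast\|^2+\frac{\gamma^2L_{\max}}{M\mu}\sum_{m=1}^M\Bigl(\|\nabla F_m(x_\ast)\|^2+\frac{N}{4M}\sigma_{m,\ast}^2\Bigr),$$ where $\sigma_{m,\ast}^2=\frac1n\sum_{j=1}^n\bigl\|\nabla f_{mj}(x_\ast)-\frac1n\nabla F_m(x_\ast)\bigr\|^2$.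
   Context: A function $\phi:\mathbb{R}^d\to\mathbb{R}$ is $L$-smooth if it is continuously differentiable and $\phi(x)-\phi(y)-\langle\nabla\phi(y),x-y\rangle\le\frac L2\|x-y\|^2$ for all $x,y$. An extended-real-valued $R$ is $\mu$-strongly convex if $R-\frac\mu2\|\cdot\|^2$ is convex. $\mathrm{prox}_{\eta R}(x)=\arg\min_{z}\{\eta R(z)+\frac12\|z-x\|^2\}$. Algorithm (FedRR / FedSO), in the case where each of the $M$ devices has $n$ functions: for each epoch $t=0,1,\dots,T-1$ and each device $m=1,\dots,M$, set $x_{t,m}^0=x_t$, take a permutation $(\pi_{0,m},\dots,\pi_{n-1,m})$ of $\{1,\dots,n\}$, and for $i=0,\dots,n-1$ set $x_{t,m}^{i+1}=x_{t,m}^i-\gamma\nabla f_{m\pi_{i,m}}(x_{t,m}^i)$. Then set $z_{t+1}=\frac1M\sum_{m=1}^M x_{t,m}^n$ and $x_{t+1}=\mathrm{prox}_{\gamma\frac NM R}(z_{t+1})$. In FedRR the permutations are uniformly random and sampled afresh (independently across devices and epochs) in every epoch; in FedSO a uniformly random permutation is sampled once for each device (independently across devices) and used in all epochs. *)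

theory Defs
  imports "HOL-Probability.Probability" "HOL-Combinatorics.Multiset_Permutations"
begin

section \<open>Gradients and smoothness\<close>

definition gradient :: "('a::real_inner \<Rightarrow> real) \<Rightarrow> 'a \<Rightarrow> 'a" where
  "gradient f x = (THE D. GDERIV f x :> D)"

lemma gradient_eq: "GDERIV f x :> D \<Longrightarrow> gradient f x = D"
  unfolding gradient_def
proof (rule the_equality)
  fix D' assume "GDERIV f x :> D" and "GDERIV f x :> D'"
  then have "(\<lambda>h. inner h D) = (\<lambda>h. inner h D')"
    unfolding gderiv_def by (rule has_derivative_unique)
  then have "inner h D' = inner h D" for h by (rule fun_cong [symmetric])
  then show "D' = D" using vector_eq_ldot by blast
qed

definition L_smooth :: "real \<Rightarrow> ('a::real_inner \<Rightarrow> real) \<Rightarrow> bool" where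
  "L_smooth L f \<longleftrightarrow>
     (\<forall>x. GDERIV f x :> gradient f x) \<and> continuous_on UNIV (gradient f) \<and>
     (\<forall>x y. f x - f y - inner (gradient f y) (x - y) \<le> L / 2 * (norm (x - y))\<^sup>2)"


section \<open>Extended-real-valued regularizers\<close>

definition ereal_epigraph :: "('a \<Rightarrow> ereal) \<Rightarrow> ('a \<times> real) set" where
  "ereal_epigraph h = {(x, r). h x \<le> ereal r}"

definition proper_fun :: "('a \<Rightarrow> ereal) \<Rightarrow> bool" where
  "proper_fun h \<longleftrightarrow> (\<forall>x. h x \<noteq> -\<infinity>) \<and> (\<exists>x. h x \<noteq> \<infinity>)"

definition closed_fun :: "('a::topological_space \<Rightarrow> ereal) \<Rightarrow> bool" where
  "closed_fun h \<longleftrightarrow> closed (ereal_epigraph h)"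

definition convex_fun :: "('a::real_vector \<Rightarrow> ereal) \<Rightarrow> bool" where
  "convex_fun h \<longleftrightarrow> convex (ereal_epigraph h)"

definition strongly_convex_fun :: "real \<Rightarrow> ('a::real_normed_vector \<Rightarrow> ereal) \<Rightarrow> bool" where
  "strongly_convex_fun \<mu> h \<longleftrightarrow> convex_fun (\<lambda>x. h x - ereal (\<mu> / 2 * (norm x)\<^sup>2))"

definition prox :: "real \<Rightarrow> ('a::real_normed_vector \<Rightarrow> ereal) \<Rightarrow> 'a \<Rightarrow> 'a" where
  "prox \<eta> R x = (ARG_MIN (\<lambda>z. ereal \<eta> * R z + ereal (1 / 2 * (norm (z - x))\<^sup>2)) z. True)"


section \<open>The algorithm for given permutations\<close>

text \<open>A permutation \<open>(\<pi>\<^sub>0, \<dots>, \<pi>\<^sub>n\<^sub>-\<^sub>1)\<close> of \<open>{1..n}\<close> is a list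
  in \<open>permutations_of_set {1..n}\<close>: positions count from 0, entries from 1.\<close>

primrec local_iterate ::
  "real \<Rightarrow> (nat \<Rightarrow> 'a::real_inner \<Rightarrow> real) \<Rightarrow> nat list \<Rightarrow> 'a \<Rightarrow> nat \<Rightarrow> 'a" where
  "local_iterate \<gamma> fm p x 0 = x"
| "local_iterate \<gamma> fm p x (Suc i) =
     local_iterate \<gamma> fm p x i - \<gamma> *\<^sub>R gradient (fm (p ! i)) (local_iterate \<gamma> fm p x i)"

text \<open>In \<open>fed_iterate \<gamma> M n f R x0 \<pi> t\<close>, the list \<open>\<pi> s m\<close> is the permutation
  used by device \<open>m\<close> in epoch \<open>s\<close>.\<close>

primrec fed_iterate ::
  "real \<Rightarrow> nat \<Rightarrow> nat \<Rightarrow> (nat \<Rightarrow> nat \<Rightarrow> 'a::real_inner \<Rightarrow> real) \<Rightarrow> ('a \<Rightarrow> ereal) \<Rightarrow> 'a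
     \<Rightarrow> (nat \<Rightarrow> nat \<Rightarrow> nat list) \<Rightarrow> nat \<Rightarrow> 'a" where
  "fed_iterate \<gamma> M n f R x0 \<pi> 0 = x0"
| "fed_iterate \<gamma> M n f R x0 \<pi> (Suc t) =
     prox (\<gamma> * (real (M * n) / real M)) R
       ((1 / real M) *\<^sub>R
          (\<Sum>m = 1..M. local_iterate \<gamma> (f m) (\<pi> t m) (fed_iterate \<gamma> M n f R x0 \<pi> t) n))"


section \<open>Sampling schemes\<close>

definition uniform_permutation :: "'w measure \<Rightarrow> nat \<Rightarrow> ('w \<Rightarrow> nat list) \<Rightarrow> bool" where
  "uniform_permutation P n X \<longleftrightarrow>
     X \<in> measurable P (count_space UNIV) \<and>
     distr P (count_space UNIV) X = measure_pmf (pmf_of_set (permutations_of_set {1..n}))"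

definition FedRR_sampling ::
  "'w measure \<Rightarrow> nat \<Rightarrow> nat \<Rightarrow> nat \<Rightarrow> (nat \<Rightarrow> nat \<Rightarrow> 'w \<Rightarrow> nat list) \<Rightarrow> bool" where
  "FedRR_sampling P M n T \<pi> \<longleftrightarrow>
     (\<forall>t<T. \<forall>m\<in>{1..M}. uniform_permutation P n (\<pi> t m)) \<and>
     prob_space.indep_vars P (\<lambda>_. count_space UNIV) (\<lambda>(t, m). \<pi> t m) ({..<T} \<times> {1..M})"

definition FedSO_sampling ::
  "'w measure \<Rightarrow> nat \<Rightarrow> nat \<Rightarrow> nat \<Rightarrow> (nat \<Rightarrow> nat \<Rightarrow> 'w \<Rightarrow> nat list) \<Rightarrow> bool" where
  "FedSO_sampling P M n T \<pi> \<longleftrightarrow>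
     (\<exists>\<rho>. (\<forall>m\<in>{1..M}. uniform_permutation P n (\<rho> m)) \<and>
          prob_space.indep_vars P (\<lambda>_. count_space UNIV) \<rho> {1..M} \<and>
          (\<forall>t<T. \<forall>m\<in>{1..M}. \<pi> t m = \<rho> m))"

end

theory Submission
  imports Defs
begin

text \<open>Fix the permutations and compare each local pass with the reference trajectory from \<open>x\<^sub>*\<close>
  whose gradients are all taken at \<open>x\<^sub>*\<close>. Since \<open>x\<^sub>*\<close> is the proximal point of the averaged end
  points of the reference trajectories, strong convexity of \<open>R\<close> contracts the squared distance
  by the factor \<open>1 / (1 + 2\<gamma>\<mu>n)\<close>, and the local passes add only the squared deviations
  of the reference trajectories from \<open>x\<^sub>*\<close>. These deviations depend on nothing but the
  permutation of one device in one epoch, so by linearity only the marginal distributions of the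
  permutations enter the expectation: reshuffling and shuffling once are covered alike, and
  the mean deviations are second moments of partial sums in sampling without replacement.\<close>

section \<open>Convexity and smoothness\<close>

lemma GDERIV_sum:
  assumes "\<And>i. i \<in> I \<Longrightarrow> GDERIV (f i) x :> D i"
  shows "GDERIV (\<lambda>x. \<Sum>i\<in>I. f i x) x :> (\<Sum>i\<in>I. D i)"
  using assms unfolding gderiv_def inner_sum_right by (intro has_derivative_sum) auto

lemma GDERIV_cmult:
  fixes c :: real
  shows "GDERIV \<phi> x :> g \<Longrightarrow> GDERIV (\<lambda>x. c * \<phi> x) x :> c *\<^sub>R g"
  unfolding gderiv_def inner_scaleR_right by (rule has_derivative_mult_right)

lemma GDERIV_line:
  assumes "GDERIV \<phi> x :> g"
  shows "((\<lambda>t::real. \<phi> (x + t *\<^sub>R d)) has_real_derivative g \<bullet> d) (at 0)"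
proof -
  have l: "((\<lambda>t::real. x + t *\<^sub>R d) has_derivative (\<lambda>t. t *\<^sub>R d)) (at 0)"
    by (auto intro!: derivative_eq_intros)
  have p: "(\<phi> has_derivative (\<lambda>h. h \<bullet> g)) (at (x + 0 *\<^sub>R d))"
    using assms unfolding gderiv_def by simp
  from has_derivative_compose[OF l p] show ?thesis
    unfolding has_field_derivative_def
    by (rule has_derivative_eq_rhs) (auto simp: inner_commute)
qed

text \<open>Dividing by \<open>t\<close> and letting \<open>t\<close> tend to 0 from the right
  removes the \<open>k\<close> term. This turns inequalities along a segment, coming from convexity
  or minimality, into first-order ones.\<close>

lemma GDERIV_ge_of_quadratic_lower_bound:
  assumes "GDERIV \<phi> x :> g"
    and bound: "\<And>t. 0 < t \<Longrightarrow> t < 1 \<Longrightarrow> c * t \<le> \<phi> (x + t *\<^sub>R d) - \<phi> x + k * t\<^sup>2"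
  shows "c \<le> g \<bullet> d"
proof -
  have "((\<lambda>t. (\<phi> (x + t *\<^sub>R d) - \<phi> x) / t) \<longlongrightarrow> g \<bullet> d) (at_right 0)"
    using GDERIV_line[OF assms(1), of d] unfolding has_field_derivative_iff
    by (auto intro: tendsto_within_subset[of _ _ _ UNIV])
  moreover have "((\<lambda>t::real. k * t) \<longlongrightarrow> k * 0) (at_right 0)"
    by (intro tendsto_intros)
  ultimately have lim: "((\<lambda>t. (\<phi> (x + t *\<^sub>R d) - \<phi> x) / t + k * t) \<longlongrightarrow> g \<bullet> d) (at_right 0)"
    using tendsto_add[of _ "g \<bullet> d" _ _ "k * 0"] by simp
  have "\<forall>\<^sub>F t in at_right (0::real). t \<in> {0<..<1}"
    by (rule eventually_at_rightI[of 0 1]) auto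
  then have "\<forall>\<^sub>F t in at_right 0. c \<le> (\<phi> (x + t *\<^sub>R d) - \<phi> x) / t + k * t"
  proof eventually_elim
    case (elim t)
    then have "c * t / t \<le> (\<phi> (x + t *\<^sub>R d) - \<phi> x + k * t\<^sup>2) / t"
      using bound[of t] by (intro divide_right_mono) auto
    then show ?case using elim by (simp add: add_divide_distrib power2_eq_square)
  qed
  from tendsto_lowerbound[OF lim this] show ?thesis by simp
qed

lemma convex_on_gradient_inequality:
  assumes "convex_on UNIV \<phi>" "GDERIV \<phi> x :> g"
  shows "\<phi> x + g \<bullet> (y - x) \<le> \<phi> y"
proof -
  have "\<phi> x - \<phi> y \<le> (- g) \<bullet> (y - x)"
  proof (rule GDERIV_ge_of_quadratic_lower_bound[where k = 0, OF GDERIV_minus[OF assms(2)]])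
    fix t :: real assume t: "0 < t" "t < 1"
    have "\<phi> ((1 - t) *\<^sub>R x + t *\<^sub>R y) \<le> (1 - t) * \<phi> x + t * \<phi> y"
      using convex_onD[OF assms(1), of t x y] t by simp
    moreover have "(1 - t) *\<^sub>R x + t *\<^sub>R y = x + t *\<^sub>R (y - x)" by (simp add: algebra_simps)
    ultimately show "(\<phi> x - \<phi> y) * t \<le> - \<phi> (x + t *\<^sub>R (y - x)) - - \<phi> x + 0 * t\<^sup>2"
      by (simp add: algebra_simps)
  qed
  then show ?thesis by (simp add: algebra_simps)
qed

lemma L_smooth_GDERIV: "L_smooth L \<phi> \<Longrightarrow> GDERIV \<phi> x :> gradient \<phi> x"
  by (simp add: L_smooth_def)

lemma L_smooth_mono: "L_smooth L \<phi> \<Longrightarrow> L \<le> L' \<Longrightarrow> L_smooth L' \<phi>"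
  unfolding L_smooth_def by (meson divide_right_mono mult_right_mono order_trans zero_le_numeral zero_le_power2)

lemma L_smooth_upper: "L_smooth L \<phi> \<Longrightarrow> \<phi> x \<le> \<phi> y + gradient \<phi> y \<bullet> (x - y) + L / 2 * (norm (x - y))\<^sup>2"
proof -
  assume "L_smooth L \<phi>"
  then have "\<phi> x - \<phi> y - gradient \<phi> y \<bullet> (x - y) \<le> L / 2 * (norm (x - y))\<^sup>2"
    by (simp add: L_smooth_def)
  then show ?thesis by linarith
qed

text \<open>Both bounds on \<open>\<phi>\<close> are evaluated at the gradient step
  \<open>x - (1 / L) (\<nabla>\<phi> x - \<nabla>\<phi> y)\<close>, which minimizes the upper one.\<close>
lemma convex_L_smooth_lower:
  assumes "convex_on UNIV \<phi>" "L_smooth L \<phi>" "L > 0"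
  shows "\<phi> y + gradient \<phi> y \<bullet> (x - y) + (norm (gradient \<phi> x - gradient \<phi> y))\<^sup>2 / (2 * L) \<le> \<phi> x"
proof -
  define u where "u = gradient \<phi> x - gradient \<phi> y"
  define z where "z = x - (1 / L) *\<^sub>R u"
  have zx: "z - x = - (1 / L) *\<^sub>R u" by (simp add: z_def)
  have zy: "z - y = (x - y) - (1 / L) *\<^sub>R u" by (simp add: z_def)
  have n: "L / 2 * (norm (z - x))\<^sup>2 = u \<bullet> u / (2 * L)"
    using assms(3) unfolding zx power2_norm_eq_inner by (simp add: field_simps)
  have lo: "\<phi> y + gradient \<phi> y \<bullet> (x - y) - (gradient \<phi> y \<bullet> u) / L \<le> \<phi> z"
    using convex_on_gradient_inequality[OF assms(1) L_smooth_GDERIV[OF assms(2)], of y z]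
    by (simp add: zy inner_diff_right)
  have up: "\<phi> z \<le> \<phi> x - (gradient \<phi> x \<bullet> u) / L + u \<bullet> u / (2 * L)"
    using L_smooth_upper[OF assms(2), of z x] n by (simp add: zx)
  have "(gradient \<phi> x \<bullet> u) / L - (gradient \<phi> y \<bullet> u) / L = u \<bullet> u / L"
    by (simp add: u_def inner_diff_left diff_divide_distrib)
  moreover have "u \<bullet> u / L = 2 * (u \<bullet> u / (2 * L))" by simp
  ultimately show ?thesis
    using lo up unfolding power2_norm_eq_inner u_def[symmetric] by linarith
qed

text \<open>Triangle inequality, then Cauchy-Schwarz; it will handle the average over devices. If
  \<open>card I = 0\<close>, both sides vanish because \<open>1 / 0 = 0\<close>.\<close>

lemma norm_mean_power2_le:
  fixes u :: "'i \<Rightarrow> 'a::real_normed_vector"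
  shows "(norm ((1 / real (card I)) *\<^sub>R (\<Sum>i\<in>I. u i)))\<^sup>2 \<le> 1 / real (card I) * (\<Sum>i\<in>I. (norm (u i))\<^sup>2)"
proof (cases "card I = 0")
  case False
  have "(norm (\<Sum>i\<in>I. u i))\<^sup>2 \<le> (\<Sum>i\<in>I. norm (u i))\<^sup>2"
    by (intro power_mono norm_sum norm_ge_zero)
  also have "\<dots> \<le> (\<Sum>i\<in>I. (norm (u i))\<^sup>2) * card I"
    using sum_squared_le_sum_of_squares[of "\<lambda>i. norm (u i)" I] False by (simp add: card_gt_0_iff)
  finally show ?thesis using False by (simp add: power_mult_distrib field_simps power2_eq_square)
qed auto

section \<open>Strongly convex regularizers and the proximal operator\<close>

lemma norm_convex_combination_power2:
  fixes x y :: "'a::real_inner"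
  shows "(norm ((1 - t) *\<^sub>R x + t *\<^sub>R y))\<^sup>2
    = (1 - t) * (norm x)\<^sup>2 + t * (norm y)\<^sup>2 - t * (1 - t) * (norm (y - x))\<^sup>2"
  unfolding power2_norm_eq_inner
  by (simp add: inner_add_left inner_add_right inner_diff_left inner_diff_right inner_commute
      algebra_simps power2_eq_square)

text \<open>Convexity of the shifted epigraph is applied to two points of the graph. When the
  quadratic is added back, the preceding identity leaves only the gain in
  \<open>t * (1 - t)\<close>.\<close>

lemma strongly_convex_fun_ineq:
  fixes h :: "'a::real_inner \<Rightarrow> ereal"
  assumes "strongly_convex_fun \<mu> h" "h x = ereal a" "h y = ereal b" "0 \<le> t" "t \<le> 1"
  shows "h ((1 - t) *\<^sub>R x + t *\<^sub>R y)
    \<le> ereal ((1 - t) * a + t * b - \<mu> / 2 * (t * (1 - t)) * (norm (y - x))\<^sup>2)"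
proof -
  let ?E = "ereal_epigraph (\<lambda>x. h x - ereal (\<mu> / 2 * (norm x)\<^sup>2))"
  let ?w = "(1 - t) *\<^sub>R x + t *\<^sub>R y"
  have E: "convex ?E" using assms(1) by (simp add: strongly_convex_fun_def convex_fun_def)
  have "(1 - t) *\<^sub>R (x, a - \<mu> / 2 * (norm x)\<^sup>2) + t *\<^sub>R (y, b - \<mu> / 2 * (norm y)\<^sup>2) \<in> ?E"
    using assms by (intro convexD[OF E]) (auto simp: ereal_epigraph_def)
  then have "h ?w - ereal (\<mu> / 2 * (norm ?w)\<^sup>2)
      \<le> ereal ((1 - t) * (a - \<mu> / 2 * (norm x)\<^sup>2) + t * (b - \<mu> / 2 * (norm y)\<^sup>2))"
    by (simp add: ereal_epigraph_def)
  then have "h ?w \<le> ereal ((1 - t) * (a - \<mu> / 2 * (norm x)\<^sup>2) + t * (b - \<mu> / 2 * (norm y)\<^sup>2)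
      + \<mu> / 2 * (norm ?w)\<^sup>2)"
    by (cases "h ?w") (auto simp: algebra_simps)
  also have "(1 - t) * (a - \<mu> / 2 * (norm x)\<^sup>2) + t * (b - \<mu> / 2 * (norm y)\<^sup>2) + \<mu> / 2 * (norm ?w)\<^sup>2
     = (1 - t) * a + t * b - \<mu> / 2 * (t * (1 - t)) * (norm (y - x))\<^sup>2"
    unfolding norm_convex_combination_power2
    by (simp add: algebra_simps add_divide_distrib diff_divide_distrib)
  finally show ?thesis .
qed

text \<open>Minimality is tested along the segment from \<open>x\<close> to \<open>y\<close>, where
  strong convexity controls \<open>R\<close>. In effect \<open>- g\<close> becomes a subgradient of
  \<open>R\<close> at \<open>x\<close> with a quadratic gain. It serves for the solution with the
  average loss and for proximal points with the squared distance.\<close>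

lemma strongly_convex_minimizer_ineq:
  fixes R :: "'a::real_inner \<Rightarrow> ereal"
  assumes R: "strongly_convex_fun \<mu> R" "\<And>y. R y \<noteq> -\<infinity>"
    and \<phi>: "GDERIV \<phi> x :> g"
    and x: "R x = ereal a"
    and min: "\<And>y b. R y = ereal b \<Longrightarrow> \<phi> x + a \<le> \<phi> y + b"
    and y: "R y = ereal b"
  shows "a - g \<bullet> (y - x) + \<mu> / 2 * (norm (y - x))\<^sup>2 \<le> b"
proof -
  let ?D = "\<mu> / 2 * (norm (y - x))\<^sup>2"
  have "a - b + ?D \<le> g \<bullet> (y - x)"
  \<comment> \<open>Of the gain \<open>?D * (t - t\<^sup>2)\<close>, the linear part enters the
    slope and the rest is the error term.\<close>
  proof (rule GDERIV_ge_of_quadratic_lower_bound[OF \<phi>, where k = ?D])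
    fix t :: real assume t: "0 < t" "t < 1"
    let ?w = "x + t *\<^sub>R (y - x)"
    have w: "(1 - t) *\<^sub>R x + t *\<^sub>R y = ?w" by (simp add: algebra_simps)
    have le: "R ?w \<le> ereal ((1 - t) * a + t * b - \<mu> / 2 * (t * (1 - t)) * (norm (y - x))\<^sup>2)"
      using strongly_convex_fun_ineq[OF R(1) x y, of t] t unfolding w by simp
    then obtain c where c: "R ?w = ereal c" using R(2)[of ?w] by (cases "R ?w") auto
    have "\<phi> x + a \<le> \<phi> ?w + ((1 - t) * a + t * b - \<mu> / 2 * (t * (1 - t)) * (norm (y - x))\<^sup>2)"
      using min[OF c] le c by simp
    then show "(a - b + ?D) * t \<le> \<phi> ?w - \<phi> x + ?D * t\<^sup>2"
      by (simp add: algebra_simps power2_eq_square diff_divide_distrib)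
  qed
  then show ?thesis by simp
qed

text \<open>The affine minorant makes the proximal objective coercive, so the part of the epigraph
  that competes with \<open>(x\<^sub>0, a)\<close> is compact.\<close>
lemma prox_is_arg_min:
  fixes R :: "'a::euclidean_space \<Rightarrow> ereal"
  assumes "closed_fun R" "\<And>y. R y \<noteq> -\<infinity>" "R x\<^sub>0 = ereal a" "\<eta> > 0"
    and minorant: "\<And>y b. R y = ereal b \<Longrightarrow> a + s \<bullet> (y - x\<^sub>0) \<le> b"
  shows "is_arg_min (\<lambda>z. ereal \<eta> * R z + ereal (1 / 2 * (norm (z - x))\<^sup>2)) (\<lambda>_. True) (prox \<eta> R x)"
proof -
  \<comment> \<open>On pairs the objective is real-valued and continuous, so that a minimum over the
    closed epigraph comes from compactness.\<close>
  define G where "G = (\<lambda>(z, r). \<eta> * r + 1 / 2 * (norm (z - x))\<^sup>2)"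
  define c where "c = G (x\<^sub>0, a)"
  define K where "K = ereal_epigraph R \<inter> {w. G w \<le> c}"
  have contG: "continuous_on S G" for S
    unfolding G_def case_prod_unfold by (intro continuous_intros)
  define C where "C = 1 / 2 * (norm (x\<^sub>0 - x))\<^sup>2 - \<eta> * (s \<bullet> (x - x\<^sub>0))"
  \<comment> \<open>A competitor at distance \<open>d\<close> from \<open>x\<close> satisfies
    \<open>d * (d - 2 * \<eta> * norm s) \<le> 2 * C\<close>. Beyond \<open>B\<close> the first
    factor is at least 1 and the second exceeds \<open>2 * \<bar>C\<bar>\<close>.\<close>
  define B where "B = 2 * \<eta> * norm s + 2 * \<bar>C\<bar> + 1"
  have "w \<in> cball x B \<times> {a - norm s * (B + norm (x - x\<^sub>0))..c / \<eta>}" if "w \<in> K" for w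
  proof -
    obtain z r where w: "w = (z, r)" by fastforce
    have Rz: "R z \<le> ereal r" and Gw: "\<eta> * r + 1 / 2 * (norm (z - x))\<^sup>2 \<le> c"
      using that by (auto simp: K_def w ereal_epigraph_def G_def)
    obtain b where b: "R z = ereal b" "b \<le> r" using Rz assms(2)[of z] by (cases "R z") auto
    have s: "s \<bullet> (z - x\<^sub>0) = s \<bullet> (z - x) + s \<bullet> (x - x\<^sub>0)" by (simp add: inner_diff_right)
    have r: "a + s \<bullet> (z - x) + s \<bullet> (x - x\<^sub>0) \<le> r" using minorant[OF b(1)] b(2) s by simp
    have cs: "- (norm s * norm (z - x)) \<le> s \<bullet> (z - x)" "- (norm s * norm (x - x\<^sub>0)) \<le> s \<bullet> (x - x\<^sub>0)"
      using Cauchy_Schwarz_ineq2[of s "z - x"] Cauchy_Schwarz_ineq2[of s "x - x\<^sub>0"] by linarith+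
    have "\<eta> * (a - norm s * norm (z - x) + s \<bullet> (x - x\<^sub>0)) \<le> \<eta> * r"
      using r cs(1) assms(4) by (intro mult_left_mono) auto
    then have q: "1 / 2 * (norm (z - x))\<^sup>2 \<le> C + \<eta> * norm s * norm (z - x)"
      using Gw unfolding c_def G_def C_def by (simp add: algebra_simps)
    have B: "norm (z - x) \<le> B"
    proof (rule ccontr)
      assume *: "\<not> norm (z - x) \<le> B"
      have "\<eta> * norm s \<ge> 0" using assms(4) by simp
      with * have 1: "norm (z - x) \<ge> 1" and 2: "norm (z - x) - 2 * \<eta> * norm s > 2 * \<bar>C\<bar>"
        unfolding B_def by linarith+
      have "1 * (norm (z - x) - 2 * \<eta> * norm s) \<le> norm (z - x) * (norm (z - x) - 2 * \<eta> * norm s)"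
        using 1 2 by (intro mult_right_mono) linarith+
      then show False using 2 q by (simp add: power2_eq_square algebra_simps)
    qed
    have "norm s * norm (z - x) \<le> norm s * B" using B by (simp add: mult_left_mono)
    then have lo: "a - norm s * (B + norm (x - x\<^sub>0)) \<le> r" using r cs by (simp add: distrib_left)
    have "\<eta> * r \<le> c" using Gw zero_le_power2[of "norm (z - x)"] by linarith
    then have "r \<le> c / \<eta>" using assms(4) by (simp add: field_simps)
    then show ?thesis using B lo by (simp add: w dist_norm norm_minus_commute)
  qed
  then have "K \<subseteq> cball x B \<times> {a - norm s * (B + norm (x - x\<^sub>0))..c / \<eta>}" by (rule subsetI)
  then have "bounded K"
    by (rule bounded_subset[rotated]) (intro bounded_Times bounded_cball bounded_closed_interval)
  moreover have "closed K"
    unfolding K_def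
    by (intro closed_Int closed_Collect_le contG continuous_on_const assms(1)[unfolded closed_fun_def])
  ultimately have "compact K" by (simp add: compact_eq_bounded_closed)
  moreover have "(x\<^sub>0, a) \<in> K" using assms(3) by (simp add: K_def c_def ereal_epigraph_def)
  ultimately obtain w where w: "w \<in> K" "\<And>v. v \<in> K \<Longrightarrow> G w \<le> G v"
    using continuous_attains_inf[OF _ _ contG, of K] by blast
  obtain p r where pr: "w = (p, r)" by fastforce
  let ?h = "\<lambda>z. ereal \<eta> * R z + ereal (1 / 2 * (norm (z - x))\<^sup>2)"
  have Rp: "R p \<le> ereal r" using w(1) by (simp add: K_def pr ereal_epigraph_def)
  then have hp: "?h p \<le> ereal (G w)"
    using assms(2)[of p] assms(4) by (cases "R p") (auto simp: G_def pr)
  have "\<not> ?h y < ?h p" for y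
  proof
    assume *: "?h y < ?h p"
    obtain b where b: "R y = ereal b"
      using * assms(2)[of y] assms(4) by (cases "R y") auto
    have lt: "G (y, b) < G w" using less_le_trans[OF * hp] b by (simp add: G_def)
    then have "(y, b) \<in> K" using b w(1) by (auto simp: K_def ereal_epigraph_def)
    from w(2)[OF this] lt show False by simp
  qed
  then have "is_arg_min ?h (\<lambda>_. True) p" by (simp add: is_arg_min_def)
  \<comment> \<open>\<open>arg_min\<close> chooses some minimizer, so the existence of one
    suffices.\<close>
  then show ?thesis unfolding prox_def arg_min_def by (rule someI)
qed

lemma GDERIV_half_norm_power2:
  "\<eta> \<noteq> 0 \<Longrightarrow> GDERIV (\<lambda>z. 1 / (2 * \<eta>) * (norm (z - x))\<^sup>2) p :> (1 / \<eta>) *\<^sub>R (p - x)"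
  unfolding gderiv_def power2_norm_eq_inner
  by (auto intro!: derivative_eq_intros simp: inner_commute algebra_simps)

text \<open>The inequality assumed for \<open>x\<^sub>0\<close> says that \<open>s - \<mu> x\<^sub>0\<close> is a subgradient of
  \<open>R - \<mu>/2 \<parallel>\<cdot>\<parallel>\<^sup>2\<close> at \<open>x\<^sub>0\<close>, so that \<open>x\<^sub>0\<close> is the proximal point of \<open>x\<^sub>0 + \<eta> s\<close>.\<close>
lemma prox_contraction:
  fixes R :: "'a::euclidean_space \<Rightarrow> ereal"
  assumes "closed_fun R" "strongly_convex_fun \<mu> R" "\<And>y. R y \<noteq> -\<infinity>" "R x\<^sub>0 = ereal a"
    and "\<eta> > 0" "\<mu> > 0"
    and subgr: "\<And>y b. R y = ereal b \<Longrightarrow> a + s \<bullet> (y - x\<^sub>0) + \<mu> / 2 * (norm (y - x\<^sub>0))\<^sup>2 \<le> b"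
  shows "(norm (prox \<eta> R z - x\<^sub>0))\<^sup>2 \<le> (norm (z - (x\<^sub>0 + \<eta> *\<^sub>R s)))\<^sup>2 / (1 + 2 * \<eta> * \<mu>)"
proof -
  define p where "p = prox \<eta> R z"
  have "a + s \<bullet> (y - x\<^sub>0) \<le> b" if "R y = ereal b" for y b
  proof -
    have "0 \<le> \<mu> / 2 * (norm (y - x\<^sub>0))\<^sup>2" using assms(6) by simp
    then show ?thesis using subgr[OF that] by linarith
  qed
  then have "is_arg_min (\<lambda>y. ereal \<eta> * R y + ereal (1 / 2 * (norm (y - z))\<^sup>2)) (\<lambda>_. True) p"
    unfolding p_def by (rule prox_is_arg_min[OF assms(1,3,4,5)])
  then have min: "ereal \<eta> * R p + ereal (1 / 2 * (norm (p - z))\<^sup>2)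
      \<le> ereal \<eta> * R y + ereal (1 / 2 * (norm (y - z))\<^sup>2)" for y
    by (auto simp: is_arg_min_def not_less)
  obtain b where b: "R p = ereal b"
    using min[of x\<^sub>0] assms(3)[of p] assms(4,5) by (cases "R p") auto
  have "b - ((1 / \<eta>) *\<^sub>R (p - z)) \<bullet> (x\<^sub>0 - p) + \<mu> / 2 * (norm (x\<^sub>0 - p))\<^sup>2 \<le> a"
  proof (rule strongly_convex_minimizer_ineq[OF assms(2,3) GDERIV_half_norm_power2 b _ assms(4)])
    show "\<eta> \<noteq> 0" using assms(5) by simp
  next
    fix y d assume "R y = ereal d"
    then have "\<eta> * b + 1 / 2 * (norm (p - z))\<^sup>2 \<le> \<eta> * d + 1 / 2 * (norm (y - z))\<^sup>2"
      using min[of y] b by simp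
    then have "(\<eta> * b + 1 / 2 * (norm (p - z))\<^sup>2) / \<eta> \<le> (\<eta> * d + 1 / 2 * (norm (y - z))\<^sup>2) / \<eta>"
      using assms(5) by (intro divide_right_mono) auto
    then show "1 / (2 * \<eta>) * (norm (p - z))\<^sup>2 + b \<le> 1 / (2 * \<eta>) * (norm (y - z))\<^sup>2 + d"
      using assms(5) by (simp add: add_divide_distrib mult.commute add.commute)
  qed
  \<comment> \<open>Adding the strong subgradient inequalities at \<open>x\<^sub>0\<close> and at
    \<open>p\<close> cancels the values of \<open>R\<close> and doubles the quadratic gain: strong
    monotonicity.\<close>
  with subgr[OF b] have "s \<bullet> (p - x\<^sub>0) - ((1 / \<eta>) *\<^sub>R (p - z)) \<bullet> (x\<^sub>0 - p) + \<mu> * (norm (p - x\<^sub>0))\<^sup>2 \<le> 0"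
    by (simp add: norm_minus_commute)
  then have "\<eta> * (s \<bullet> (p - x\<^sub>0) - ((1 / \<eta>) *\<^sub>R (p - z)) \<bullet> (x\<^sub>0 - p) + \<mu> * (norm (p - x\<^sub>0))\<^sup>2) \<le> 0"
    using assms(5) by (simp add: mult_le_0_iff)
  then have "\<eta> * (s \<bullet> (p - x\<^sub>0)) - (p - z) \<bullet> (x\<^sub>0 - p) + \<eta> * \<mu> * (norm (p - x\<^sub>0))\<^sup>2 \<le> 0"
    using assms(5) by (simp add: algebra_simps)
  moreover define e where "e = z - (x\<^sub>0 + \<eta> *\<^sub>R s)"
  moreover have "\<eta> * (s \<bullet> (p - x\<^sub>0)) - (p - z) \<bullet> (x\<^sub>0 - p) = (norm (p - x\<^sub>0))\<^sup>2 - e \<bullet> (p - x\<^sub>0)"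
    unfolding e_def power2_norm_eq_inner
    by (simp add: inner_diff_left inner_diff_right inner_add_left inner_add_right inner_commute)
  \<comment> \<open>Young's inequality uses up one of two copies of the squared distance, leaving
    the factor \<open>1 + 2 * \<eta> * \<mu>\<close>.\<close>
  moreover have "2 * (e \<bullet> (p - x\<^sub>0)) \<le> (norm e)\<^sup>2 + (norm (p - x\<^sub>0))\<^sup>2"
    using zero_le_power2[of "norm (e - (p - x\<^sub>0))"]
    unfolding power2_norm_eq_inner by (simp add: inner_diff_left inner_diff_right inner_commute)
  ultimately have "(1 + 2 * \<eta> * \<mu>) * (norm (p - x\<^sub>0))\<^sup>2 \<le> (norm e)\<^sup>2"
    by (simp add: algebra_simps)
  moreover have "1 + 2 * \<eta> * \<mu> > 0" using assms(5,6) by (simp add: add_pos_pos)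
  ultimately show ?thesis unfolding p_def e_def by (simp add: field_simps)
qed

section \<open>One local pass\<close>

text \<open>The reference trajectory freezes all gradients at \<open>y\<close>. Expanding the squared distance and
  using the three-point identity for Bregman divergences, the only term with the wrong sign
  is the divergence from \<open>y\<close> to the reference point.\<close>
lemma local_iterate_dist:
  fixes fm :: "nat \<Rightarrow> 'a::real_inner \<Rightarrow> real"
  assumes "\<And>i. i < n \<Longrightarrow> convex_on UNIV (fm (p ! i))" "\<And>i. i < n \<Longrightarrow> L_smooth L (fm (p ! i))"
    and "0 < L" "0 < \<gamma>" "\<gamma> \<le> 1 / L"
  shows "(norm (local_iterate \<gamma> fm p x n - (y - \<gamma> *\<^sub>R (\<Sum>j<n. gradient (fm (p ! j)) y))))\<^sup>2
    \<le> (norm (x - y))\<^sup>2 + \<gamma> ^ 3 * L * (\<Sum>i<n. (norm (\<Sum>j<i. gradient (fm (p ! j)) y))\<^sup>2)"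
  using assms(1,2)
proof (induction n)
  case (Suc n)
  define X where "X = local_iterate \<gamma> fm p x n"
  define S where "S = (\<Sum>j<n. gradient (fm (p ! j)) y)"
  define Y where "Y = y - \<gamma> *\<^sub>R S"
  define h where "h = fm (p ! n)"
  define u where "u = gradient h X - gradient h y"
  have h: "convex_on UNIV h" "L_smooth L h" using Suc.prems[of n] by (simp_all add: h_def)
  \<comment> \<open>Convexity at \<open>X\<close>, its sharpened form at \<open>y\<close> and
    smoothness at \<open>y\<close> add up so that all values of \<open>h\<close> cancel.\<close>
  have "h X + gradient h X \<bullet> (Y - X) \<le> h Y"
    by (rule convex_on_gradient_inequality[OF h(1) L_smooth_GDERIV[OF h(2)]])
  moreover have "h y + gradient h y \<bullet> (X - y) + (norm u)\<^sup>2 / (2 * L) \<le> h X"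
    unfolding u_def by (rule convex_L_smooth_lower[OF h assms(3)])
  moreover have "h Y \<le> h y + gradient h y \<bullet> (Y - y) + L / 2 * (norm (Y - y))\<^sup>2"
    by (rule L_smooth_upper[OF h(2)])
  moreover have "(norm (Y - y))\<^sup>2 = \<gamma>\<^sup>2 * (norm S)\<^sup>2" by (simp add: Y_def power_mult_distrib)
  ultimately have "(norm u)\<^sup>2 / (2 * L) - L / 2 * (\<gamma>\<^sup>2 * (norm S)\<^sup>2) \<le> u \<bullet> (X - Y)"
    unfolding u_def inner_diff_left inner_diff_right by (simp add: algebra_simps)
  then have "2 * \<gamma> * ((norm u)\<^sup>2 / (2 * L) - L / 2 * (\<gamma>\<^sup>2 * (norm S)\<^sup>2)) \<le> 2 * \<gamma> * (u \<bullet> (X - Y))"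
    using assms(4) by simp
  then have "\<gamma> * (1 / L * (norm u)\<^sup>2) - \<gamma> ^ 3 * L * (norm S)\<^sup>2 \<le> 2 * \<gamma> * (u \<bullet> (X - Y))"
    by (simp add: algebra_simps power2_eq_square power3_eq_cube)
  \<comment> \<open>The stepsize bound lets the gain from co-coercivity absorb the quadratic term of
    the gradient step.\<close>
  moreover have "\<gamma> * (\<gamma> * (norm u)\<^sup>2) \<le> \<gamma> * (1 / L * (norm u)\<^sup>2)"
    using assms(4,5) by (intro mult_left_mono mult_right_mono) auto
  moreover have "(norm ((X - \<gamma> *\<^sub>R gradient h X) - (Y - \<gamma> *\<^sub>R gradient h y)))\<^sup>2
      = (norm (X - Y))\<^sup>2 - 2 * \<gamma> * (u \<bullet> (X - Y)) + \<gamma> * (\<gamma> * (norm u)\<^sup>2)"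
  proof -
    have "(X - \<gamma> *\<^sub>R gradient h X) - (Y - \<gamma> *\<^sub>R gradient h y) = (X - Y) - \<gamma> *\<^sub>R u"
      by (simp add: u_def algebra_simps)
    moreover have "(norm ((X - Y) - \<gamma> *\<^sub>R u))\<^sup>2 = (norm (X - Y))\<^sup>2 - 2 * \<gamma> * (u \<bullet> (X - Y)) + \<gamma> * (\<gamma> * (norm u)\<^sup>2)"
      for u
      unfolding power2_norm_eq_inner
      by (simp add: inner_diff_left inner_diff_right inner_commute algebra_simps)
    ultimately show ?thesis by (simp only:)
  qed
  ultimately have "(norm ((X - \<gamma> *\<^sub>R gradient h X) - (Y - \<gamma> *\<^sub>R gradient h y)))\<^sup>2
      \<le> (norm (X - Y))\<^sup>2 + \<gamma> ^ 3 * L * (norm S)\<^sup>2" by linarith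
  moreover have "(norm (X - Y))\<^sup>2 \<le> (norm (x - y))\<^sup>2
      + \<gamma> ^ 3 * L * (\<Sum>i<n. (norm (\<Sum>j<i. gradient (fm (p ! j)) y))\<^sup>2)"
    unfolding X_def Y_def S_def using Suc by simp
  ultimately show ?case
    by (simp add: X_def Y_def S_def h_def algebra_simps)
qed simp

section \<open>Sampling without replacement\<close>

lemma permutation_nth_bij_betw:
  assumes "p \<in> permutations_of_set {1..n}"
  shows "bij_betw (\<lambda>i. p ! i) {..<n} {1..n}"
  using bij_betw_nth[of p] permutations_of_setD[OF assms]
    length_finite_permutations_of_set[OF assms] by simp

lemma sum_permutation_nth:
  assumes "p \<in> permutations_of_set {1..n}"
  shows "(\<Sum>i<n. g (p ! i)) = (\<Sum>j = 1..n. g j)"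
  using sum.reindex_bij_betw[OF permutation_nth_bij_betw[OF assms]] .

lemma bij_betw_permute_list_permutations_of_set:
  assumes "\<sigma> permutes {..<card A}"
  shows "bij_betw (permute_list \<sigma>) (permutations_of_set A) (permutations_of_set A)"
proof -
  have maps: "permute_list \<tau> p \<in> permutations_of_set A"
    if "\<tau> permutes {..<card A}" "p \<in> permutations_of_set A" for \<tau> p
  proof -
    have "\<tau> permutes {..<length p}" using that length_finite_permutations_of_set by metis
    then show ?thesis using permutations_of_setD[OF that(2)] by (intro permutations_of_setI) simp_all
  qed
  have inverse: "permute_list (\<tau> \<circ> \<tau>') p = permute_list \<tau>' (permute_list \<tau> p)"
    if "\<tau>' permutes {..<card A}" "p \<in> permutations_of_set A" for \<tau> \<tau>' p
    using that length_finite_permutations_of_set by (metis permute_list_compose)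
  have i: "inv \<sigma> permutes {..<card A}" using assms by (rule permutes_inv)
  show ?thesis
    by (rule bij_betw_byWitness[where f' = "permute_list (inv \<sigma>)"])
      (use assms i maps in \<open>auto simp: inverse[symmetric] permutes_inv_o\<close>)
qed

text \<open>Reindexing by \<open>permute_list \<sigma>\<close>, which reads position
  \<open>i\<close> from \<open>\<sigma> i\<close>, expresses the exchangeability of
  positions.\<close>

lemma sum_permutations_of_set_swap:
  assumes "i < n" "j < n" "k < n" "l < n" "\<sigma> permutes {..<n}" "\<sigma> i = k" "\<sigma> j = l"
  shows "(\<Sum>p\<in>permutations_of_set {1..n}. g (p ! i) (p ! j))
    = (\<Sum>p\<in>permutations_of_set {1..n}. g (p ! k) (p ! l))"
proof -
  have "(\<Sum>p\<in>permutations_of_set {1..n}. g (p ! k) (p ! l))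
      = (\<Sum>p\<in>permutations_of_set {1..n}. g (permute_list \<sigma> p ! i) (permute_list \<sigma> p ! j))"
  proof (rule sum.cong[OF refl])
    fix p assume "p \<in> permutations_of_set {1..n}"
    then have "length p = n" using length_finite_permutations_of_set by fastforce
    then show "g (p ! k) (p ! l) = g (permute_list \<sigma> p ! i) (permute_list \<sigma> p ! j)"
      using assms by (simp add: permute_list_nth)
  qed
  also have "\<dots> = (\<Sum>p\<in>permutations_of_set {1..n}. g (p ! i) (p ! j))"
    using assms(5) by (intro sum.reindex_bij_betw bij_betw_permute_list_permutations_of_set) simp
  finally show ?thesis by simp
qed

section \<open>Second moments of partial sums\<close>

lemma norm_sum_power2:
  fixes v :: "'i \<Rightarrow> 'a::real_inner"
  shows "(norm (\<Sum>i\<in>I. v i))\<^sup>2 = (\<Sum>i\<in>I. \<Sum>j\<in>I. v i \<bullet> v j)"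
  unfolding power2_norm_eq_inner inner_sum_left inner_sum_right by (rule sum.swap)

lemma sum_diagonal_off_diagonal:
  "(\<Sum>i<k. \<Sum>j<k. if i = j then a else b) = real k * a + real k * (real k - 1) * b"
proof -
  have "(\<Sum>i<k. \<Sum>j<k. if i = j then a else b) = (\<Sum>i<k. \<Sum>j<k. b + (if i = j then a - b else 0))"
    by (intro sum.cong) auto
  also have "\<dots> = real k * (real k * b + (a - b))" by (simp add: sum.distrib)
  finally show ?thesis by (simp add: algebra_simps)
qed

text \<open>By symmetry, the inner product of the \<open>i\<close>-th and the \<open>j\<close>-th sampled vector, summed over all
  permutations, takes one value \<open>a\<close> for \<open>i = j\<close> and one value \<open>b\<close> for \<open>i \<noteq> j\<close>.
  The full sum \<open>k = n\<close> and the sum of squares do not depend on the permutation,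
  and this determines \<open>a\<close> and \<open>b\<close>.\<close>
lemma sum_permutations_norm_partial_sum:
  fixes v :: "nat \<Rightarrow> 'a::real_inner" and n :: nat
  defines "S \<equiv> (norm (\<Sum>j = 1..n. v j))\<^sup>2" and "Q \<equiv> (\<Sum>j = 1..n. (norm (v j))\<^sup>2)"
  assumes "k \<le> n" "n \<ge> 2"
  shows "(\<Sum>p\<in>permutations_of_set {1..n}. (norm (\<Sum>j<k. v (p ! j)))\<^sup>2)
    = fact n * (real k * Q / real n + real k * (real k - 1) * (S - Q) / (real n * (real n - 1)))"
proof -
  let ?P = "permutations_of_set {1..n}"
  define A where "A i j = (\<Sum>p\<in>?P. v (p ! i) \<bullet> v (p ! j))" for i j
  define a where "a = A 0 0"
  define b where "b = A 0 1"
  have swap: "A (\<sigma> i) (\<sigma> j) = A i j" if "\<sigma> permutes {..<n}" "i < n" "j < n" for \<sigma> i j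
    unfolding A_def using that permutes_in_image[OF that(1)]
    by (intro sum_permutations_of_set_swap[symmetric]) auto
  have comm: "A i j = A j i" for i j unfolding A_def by (simp add: inner_commute)
  have trans: "Transposition.transpose i j permutes {..<n}" if "i < n" "j < n" for i j
    using that by (intro permutes_swap_id) auto
  have diag: "A i i = a" if "i < n" for i
    using swap[OF trans[of i 0], of 0 0] that by (simp add: a_def)
  \<comment> \<open>The transposition of \<open>i\<close> and \<open>k\<close> fixes
    \<open>j\<close>. With the symmetry of \<open>A\<close>, such replacements carry any
    off-diagonal pair to positions 0 and 1.\<close>
  have first: "A i j = A k j" if "i < n" "j < n" "k < n" "i \<noteq> j" "k \<noteq> j" for i j k
    using swap[OF trans[of i k], of k j] that by (simp add: transpose_apply_other)
  have off: "A i j = b" if "i < n" "j < n" "i \<noteq> j" for i j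
  proof (cases "j = 0")
    case True
    then show ?thesis using first[of i 0 1] comm[of 1 0] that assms(4) by (simp add: b_def)
  next
    case False
    then show ?thesis
      using first[of i j 0] comm[of 0 j] first[of j 0 1] comm[of 1 0] that assms(4)
      by (simp add: b_def)
  qed
  have partial: "(\<Sum>p\<in>?P. (norm (\<Sum>j<k. v (p ! j)))\<^sup>2) = real k * a + real k * (real k - 1) * b"
    if "k \<le> n" for k
  proof -
    have "(\<Sum>p\<in>?P. (norm (\<Sum>j<k. v (p ! j)))\<^sup>2) = (\<Sum>i<k. \<Sum>j<k. A i j)"
      unfolding norm_sum_power2 A_def
      by (subst sum.swap) (intro sum.cong refl sum.swap)
    also have "\<dots> = (\<Sum>i<k. \<Sum>j<k. if i = j then a else b)"
      using that by (intro sum.cong) (auto simp: diag off)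
    finally show ?thesis by (simp only: sum_diagonal_off_diagonal)
  qed
  have "real n * a = (\<Sum>i<n. A i i)" by (simp add: diag)
  also have "\<dots> = (\<Sum>p\<in>?P. \<Sum>i<n. (norm (v (p ! i)))\<^sup>2)"
    unfolding A_def power2_norm_eq_inner by (rule sum.swap)
  also have "\<dots> = (\<Sum>p\<in>?P. Q)" unfolding Q_def by (intro sum.cong refl sum_permutation_nth)
  also have "\<dots> = fact n * Q" by simp
  finally have a: "a = fact n * Q / real n" using assms(4) by (simp add: field_simps)
  have "real n * a + real n * (real n - 1) * b = fact n * S"
    unfolding partial[OF order_refl, symmetric] by (simp add: sum_permutation_nth S_def)
  moreover have "real n * a = fact n * Q" using a assms(4) by simp
  ultimately have "(real n * (real n - 1)) * b = fact n * (S - Q)" by (simp add: algebra_simps)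
  then have "b = fact n * (S - Q) / (real n * (real n - 1))"
    using assms(4) by (simp add: field_simps)
  then show ?thesis
    unfolding partial[OF assms(3)] a by (simp add: distrib_left mult.left_commute)
qed

lemma sum_lessThan_real: "(\<Sum>i<n. real i) = real n * (real n - 1) / 2"
  by (induction n) (auto simp: field_simps)

lemma sum_lessThan_real_falling: "(\<Sum>i<n. real i * (real i - 1)) = real n * (real n - 1) * (real n - 2) / 3"
  by (induction n) (auto simp: field_simps)

text \<open>For \<open>n \<ge> 2\<close> the left-hand side equals \<open>n! (Q (n + 1) / 6 + S (n - 2) / 3)\<close>, where \<open>S\<close> is the
  squared norm of the sum and \<open>Q\<close> the sum of the squared norms; the variance of the
  vectors is \<open>Q / n - S / n\<^sup>2\<close>.\<close>
lemma sum_permutations_shuffling_deviation: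
  fixes v :: "nat \<Rightarrow> 'a::real_inner" and n :: nat
  defines "V \<equiv> (\<Sum>j = 1..n. v j)"
  assumes "n \<ge> 1"
  shows "(\<Sum>p\<in>permutations_of_set {1..n}. \<Sum>i<n. (norm (\<Sum>j<i. v (p ! j)))\<^sup>2)
    \<le> fact n * (2 * real n * ((norm V)\<^sup>2 + real n / 4 *
        (1 / real n * (\<Sum>j = 1..n. (norm (v j - (1 / real n) *\<^sub>R V))\<^sup>2))))"
proof (cases "n = 1")
  case True
  \<comment> \<open>Only the empty prefix occurs, so the left-hand side is 0.\<close>
  then show ?thesis by (simp add: sum_nonneg)
next
  case False
  then have n: "n \<ge> 2" using assms(2) by simp
  let ?P = "permutations_of_set {1..n}"
  define S where "S = (norm V)\<^sup>2"
  define Q where "Q = (\<Sum>j = 1..n. (norm (v j))\<^sup>2)"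
  have "(norm (v j - (1 / real n) *\<^sub>R V))\<^sup>2 = (norm (v j))\<^sup>2 - 2 / real n * (v j \<bullet> V) + S / (real n)\<^sup>2" for j
    unfolding S_def power2_norm_eq_inner
    by (simp add: inner_diff_left inner_diff_right inner_commute power2_eq_square)
  then have "(\<Sum>j = 1..n. (norm (v j - (1 / real n) *\<^sub>R V))\<^sup>2)
      = Q - 2 / real n * (V \<bullet> V) + real n * (S / (real n)\<^sup>2)"
    by (simp add: sum.distrib sum_subtractf Q_def V_def inner_sum_left
        flip: sum_distrib_left sum_divide_distrib)
  then have var: "(\<Sum>j = 1..n. (norm (v j - (1 / real n) *\<^sub>R V))\<^sup>2) = Q - S / real n"
    using n by (simp add: S_def power2_norm_eq_inner[symmetric] power2_eq_square[of "real n"] field_simps)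
  have "(\<Sum>p\<in>?P. \<Sum>i<n. (norm (\<Sum>j<i. v (p ! j)))\<^sup>2)
      = (\<Sum>i<n. \<Sum>p\<in>?P. (norm (\<Sum>j<i. v (p ! j)))\<^sup>2)" by (rule sum.swap)
  also have "\<dots> = (\<Sum>i<n. fact n * (real i * Q / real n
      + real i * (real i - 1) * (S - Q) / (real n * (real n - 1))))"
    using n unfolding S_def Q_def V_def
    by (intro sum.cong refl sum_permutations_norm_partial_sum) auto
  also have "\<dots> = fact n * ((\<Sum>i<n. real i) * (Q / real n)
      + (\<Sum>i<n. real i * (real i - 1)) * ((S - Q) / (real n * (real n - 1))))"
    by (simp add: sum.distrib flip: sum_distrib_left sum_distrib_right sum_divide_distrib)
  also have "\<dots> = fact n * (Q * (real n + 1) / 6 + S * (real n - 2) / 3)"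
    unfolding sum_lessThan_real sum_lessThan_real_falling
    using n by (simp add: divide_simps) (simp add: algebra_simps)
  \<comment> \<open>Inserting \<open>var\<close> into the target gives these coefficients of
    \<open>S\<close> and \<open>Q\<close>; as both quantities are nonnegative, they can be compared
    separately.\<close>
  also have "\<dots> \<le> fact n * (S * (2 * real n - 1 / 2) + Q * (real n / 2))"
  proof -
    have "Q * ((real n + 1) / 6) \<le> Q * (real n / 2)"
      using n by (intro mult_left_mono) (auto simp: Q_def sum_nonneg)
    moreover have "S * ((real n - 2) / 3) \<le> S * (2 * real n - 1 / 2)"
      using n by (intro mult_left_mono) (auto simp: S_def)
    ultimately show ?thesis by (intro mult_left_mono) auto
  qed
  also have "\<dots> = fact n * (2 * real n * (S + real n / 4 * (1 / real n * (Q - S / real n))))"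
    using n by (simp add: field_simps)
  finally show ?thesis unfolding var S_def .
qed

section \<open>Almost sure statements and expectations for uniform permutations\<close>

lemma uniform_permutation_AE:
  assumes "uniform_permutation P n X"
  shows "AE \<omega> in P. X \<omega> \<in> permutations_of_set {1..n}"
proof -
  have "AE p in distr P (count_space UNIV) X. p \<in> permutations_of_set {1..n}"
    using AE_measure_pmf[of "pmf_of_set (permutations_of_set {1..n})"] assms
    unfolding uniform_permutation_def by (metis finite_atLeastAtMost finite_permutations_of_set
        permutations_of_set_empty_iff set_pmf_of_set)
  then show ?thesis using assms by (auto simp: uniform_permutation_def dest: AE_distrD[rotated])
qed

lemma uniform_permutation_expectation:
  fixes g :: "nat list \<Rightarrow> real"
  assumes "uniform_permutation P n X"
  shows "integrable P (\<lambda>\<omega>. g (X \<omega>))"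
    and "(\<integral>\<omega>. g (X \<omega>) \<partial>P) = (\<Sum>p\<in>permutations_of_set {1..n}. g p) / fact n"
proof -
  let ?\<nu> = "pmf_of_set (permutations_of_set {1..n})"
  have X: "X \<in> measurable P (count_space UNIV)" "distr P (count_space UNIV) X = measure_pmf ?\<nu>"
    using assms by (auto simp: uniform_permutation_def)
  have "integrable (measure_pmf ?\<nu>) g" by (intro integrable_measure_pmf_finite) simp
  then show "integrable P (\<lambda>\<omega>. g (X \<omega>))"
    using integrable_distr_eq[OF X(1), of g] X(2) by simp
  have "(\<integral>\<omega>. g (X \<omega>) \<partial>P) = (\<integral>p. g p \<partial>measure_pmf ?\<nu>)"
    using integral_distr[OF X(1), of g] X(2) by simp
  then show "(\<integral>\<omega>. g (X \<omega>) \<partial>P) = (\<Sum>p\<in>permutations_of_set {1..n}. g p) / fact n"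
    by (simp add: integral_pmf_of_set)
qed

section \<open>Convergence\<close>

text \<open>Comparison with a point where \<open>R\<close> is finite shows that \<open>R\<close> is
  finite at the minimizer, which reduces minimality to real numbers.\<close>

lemma is_arg_min_composite:
  fixes R :: "'a \<Rightarrow> ereal" and \<phi> :: "'a \<Rightarrow> real"
  assumes "is_arg_min (\<lambda>x. ereal (\<phi> x) + R x) (\<lambda>_. True) x" "proper_fun R"
  obtains a where "R x = ereal a" "\<And>y b. R y = ereal b \<Longrightarrow> \<phi> x + a \<le> \<phi> y + b"
proof -
  have min: "ereal (\<phi> x) + R x \<le> ereal (\<phi> y) + R y" for y
    using assms(1) by (auto simp: is_arg_min_def not_less)
  obtain y where y: "R y \<noteq> \<infinity>" using assms(2) by (auto simp: proper_fun_def)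
  have R: "R z \<noteq> -\<infinity>" for z using assms(2) by (auto simp: proper_fun_def)
  obtain a where a: "R x = ereal a"
    using min[of y] y R[of x] R[of y] by (cases "R x"; cases "R y") auto
  show thesis
  proof (rule that[OF a])
    fix y b assume "R y = ereal b"
    then show "\<phi> x + a \<le> \<phi> y + b" using min[of y] a by simp
  qed
qed

text \<open>Optimality of \<open>y\<close> makes the negative average gradient \<open>s\<close> a
  strong subgradient of \<open>R\<close>, so \<open>prox_contraction\<close> compares the epoch with
  \<open>y + \<gamma> n s\<close>. The remaining distance is split over devices by
  \<open>norm_mean_power2_le\<close> and bounded on each by
  \<open>local_iterate_dist\<close>.\<close>

lemma fed_epoch_dist:
  fixes R :: "'a::euclidean_space \<Rightarrow> ereal" and f :: "nat \<Rightarrow> nat \<Rightarrow> 'a \<Rightarrow> real"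
  assumes "M \<ge> 1" "n \<ge> 1" "0 < L" "0 < \<gamma>" "\<gamma> \<le> 1 / L" "0 < \<mu>"
    and f: "\<And>m i. m \<in> {1..M} \<Longrightarrow> i \<in> {1..n} \<Longrightarrow> convex_on UNIV (f m i)"
      "\<And>m i. m \<in> {1..M} \<Longrightarrow> i \<in> {1..n} \<Longrightarrow> L_smooth L (f m i)"
    and R: "proper_fun R" "closed_fun R" "strongly_convex_fun \<mu> R"
    and y: "is_arg_min (\<lambda>x. ereal (1 / real (M * n) * (\<Sum>m = 1..M. \<Sum>i = 1..n. f m i x)) + R x)
      (\<lambda>_. True) y"
    and p: "\<And>m. m \<in> {1..M} \<Longrightarrow> p m \<in> permutations_of_set {1..n}"
  shows "(norm (prox (\<gamma> * (real (M * n) / real M)) R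
        ((1 / real M) *\<^sub>R (\<Sum>m = 1..M. local_iterate \<gamma> (f m) (p m) x n)) - y))\<^sup>2
    \<le> ((norm (x - y))\<^sup>2 + \<gamma> ^ 3 * L / real M *
        (\<Sum>m = 1..M. \<Sum>i<n. (norm (\<Sum>j<i. gradient (f m (p m ! j)) y))\<^sup>2)) / (1 + 2 * \<gamma> * \<mu> * real n)"
proof -
  define V where "V m = (\<Sum>i = 1..n. gradient (f m i) y)" for m
  define s where "s = - ((1 / real (M * n)) *\<^sub>R (\<Sum>m = 1..M. V m))"
  define X where "X m = local_iterate \<gamma> (f m) (p m) x n" for m
  define D where "D m = (\<Sum>i<n. (norm (\<Sum>j<i. gradient (f m (p m ! j)) y))\<^sup>2)" for m
  define z where "z = (1 / real M) *\<^sub>R (\<Sum>m = 1..M. X m)"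
  have \<eta>: "\<gamma> * (real (M * n) / real M) = \<gamma> * real n" using assms(1) by simp
  have \<eta>s: "(\<gamma> * real n) *\<^sub>R s = - ((\<gamma> / real M) *\<^sub>R (\<Sum>m = 1..M. V m))"
    using assms(2) by (simp add: s_def)
  have Rm: "R z \<noteq> -\<infinity>" for z using R(1) by (auto simp: proper_fun_def)
  obtain a where a: "R y = ereal a" and min: "\<And>z b. R z = ereal b \<Longrightarrow>
      1 / real (M * n) * (\<Sum>m = 1..M. \<Sum>i = 1..n. f m i y) + a
      \<le> 1 / real (M * n) * (\<Sum>m = 1..M. \<Sum>i = 1..n. f m i z) + b"
    using is_arg_min_composite[OF y R(1)] by metis
  have "GDERIV (\<lambda>x. 1 / real (M * n) * (\<Sum>m = 1..M. \<Sum>i = 1..n. f m i x)) y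
      :> (1 / real (M * n)) *\<^sub>R (\<Sum>m = 1..M. V m)"
    unfolding V_def using f(2) by (intro GDERIV_cmult GDERIV_sum L_smooth_GDERIV) auto
  from strongly_convex_minimizer_ineq[OF R(3) Rm this a min]
  have subgr: "a + s \<bullet> (z - y) + \<mu> / 2 * (norm (z - y))\<^sup>2 \<le> b" if "R z = ereal b" for z b
    using that by (simp add: s_def)
  have "z - (y + (\<gamma> * real n) *\<^sub>R s) = (1 / real M) *\<^sub>R (\<Sum>m = 1..M. X m - (y - \<gamma> *\<^sub>R V m))"
    using assms(1) unfolding \<eta>s z_def
    by (simp add: sum_subtractf sum.distrib sum_constant_scaleR algebra_simps
        flip: scaleR_right.sum)
  then have "(norm (z - (y + (\<gamma> * real n) *\<^sub>R s)))\<^sup>2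
      \<le> 1 / real M * (\<Sum>m = 1..M. (norm (X m - (y - \<gamma> *\<^sub>R V m)))\<^sup>2)"
    using norm_mean_power2_le[of "{1..M}" "\<lambda>m. X m - (y - \<gamma> *\<^sub>R V m)"] by simp
  also have "\<dots> \<le> 1 / real M * (\<Sum>m = 1..M. (norm (x - y))\<^sup>2 + \<gamma> ^ 3 * L * D m)"
  proof (intro mult_left_mono sum_mono)
    fix m assume m: "m \<in> {1..M}"
    have "p m ! i \<in> {1..n}" if "i < n" for i
      using bij_betwE[OF permutation_nth_bij_betw[OF p[OF m]]] that by auto
    then have "(norm (X m - (y - \<gamma> *\<^sub>R (\<Sum>j<n. gradient (f m (p m ! j)) y))))\<^sup>2
        \<le> (norm (x - y))\<^sup>2 + \<gamma> ^ 3 * L * D m"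
      unfolding X_def D_def using f m assms(3-5) by (intro local_iterate_dist) auto
    \<comment> \<open>A full pass meets every function once, so its reference end point is
      independent of the order.\<close>
    then show "(norm (X m - (y - \<gamma> *\<^sub>R V m)))\<^sup>2 \<le> (norm (x - y))\<^sup>2 + \<gamma> ^ 3 * L * D m"
      unfolding V_def sum_permutation_nth[OF p[OF m], of "\<lambda>i. gradient (f m i) y"] .
  qed simp
  also have "\<dots> = (norm (x - y))\<^sup>2 + \<gamma> ^ 3 * L / real M * (\<Sum>m = 1..M. D m)"
    using assms(1) by (simp add: sum.distrib distrib_left flip: sum_distrib_left)
  finally have z: "(norm (z - (y + (\<gamma> * real n) *\<^sub>R s)))\<^sup>2
      \<le> (norm (x - y))\<^sup>2 + \<gamma> ^ 3 * L / real M * (\<Sum>m = 1..M. D m)" .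
  have "(norm (prox (\<gamma> * real n) R z - y))\<^sup>2
      \<le> (norm (z - (y + (\<gamma> * real n) *\<^sub>R s)))\<^sup>2 / (1 + 2 * (\<gamma> * real n) * \<mu>)"
    using assms(2,4,6) by (intro prox_contraction[OF R(2,3) Rm a _ _ subgr]) auto
  also have "\<dots> \<le> ((norm (x - y))\<^sup>2 + \<gamma> ^ 3 * L / real M * (\<Sum>m = 1..M. D m)) / (1 + 2 * (\<gamma> * real n) * \<mu>)"
    using z assms(4,6) by (intro divide_right_mono) auto
  finally show ?thesis unfolding \<eta> z_def X_def D_def by (simp add: mult.commute mult.left_commute)
qed

lemma sampling_uniform_permutation:
  assumes "FedRR_sampling P M n T \<pi> \<or> FedSO_sampling P M n T \<pi>" "t < T" "m \<in> {1..M}"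
  shows "uniform_permutation P n (\<pi> t m)"
  using assms unfolding FedRR_sampling_def FedSO_sampling_def by metis

theorem theorem7:
  fixes M n N T :: nat
    and f :: "nat \<Rightarrow> nat \<Rightarrow> real ^ 'd \<Rightarrow> real"
    and F :: "nat \<Rightarrow> real ^ 'd \<Rightarrow> real"
    and L :: "nat \<Rightarrow> real"
    and R :: "real ^ 'd \<Rightarrow> ereal"
    and \<mu> \<gamma> Lmax :: real
    and x0 xs :: "real ^ 'd"
    and \<sigma>2 :: "nat \<Rightarrow> real"
    and P :: "'w measure"
    and \<pi> :: "nat \<Rightarrow> nat \<Rightarrow> 'w \<Rightarrow> nat list"
  assumes "M \<ge> 1" and "n \<ge> 1" and "N = M * n"
    and "\<And>m i. m \<in> {1..M} \<Longrightarrow> i \<in> {1..n} \<Longrightarrow> convex_on UNIV (f m i)"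
    and "\<And>m i. m \<in> {1..M} \<Longrightarrow> i \<in> {1..n} \<Longrightarrow> L_smooth (L i) (f m i)"
    and "\<And>i. i \<in> {1..n} \<Longrightarrow> L i > 0"
    and "Lmax = Max (L ` {1..n})"
    and "\<And>m x. F m x = (\<Sum>j = 1..n. f m j x)"
    and "proper_fun R" and "closed_fun R" and "\<mu> > 0" and "strongly_convex_fun \<mu> R"
    and "is_arg_min (\<lambda>x. ereal (1 / real N * (\<Sum>m = 1..M. F m x)) + R x) (\<lambda>_. True) xs"
    and "\<And>m. \<sigma>2 m = 1 / real n *
           (\<Sum>j = 1..n. (norm (gradient (f m j) xs - (1 / real n) *\<^sub>R gradient (F m) xs))\<^sup>2)"
    and "0 < \<gamma>" and "\<gamma> \<le> 1 / Lmax"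
    and "prob_space P"
    and "FedRR_sampling P M n T \<pi> \<or> FedSO_sampling P M n T \<pi>"
  shows "(\<integral>\<omega>. (norm (fed_iterate \<gamma> M n f R x0 (\<lambda>t m. \<pi> t m \<omega>) T - xs))\<^sup>2 \<partial>P)
     \<le> (1 + 2 * \<gamma> * \<mu> * real n) powi (- int T) * (norm (x0 - xs))\<^sup>2
       + \<gamma>\<^sup>2 * Lmax / (real M * \<mu>) *
         (\<Sum>m = 1..M. (norm (gradient (F m) xs))\<^sup>2 + real N / (4 * real M) * \<sigma>2 m)"
proof -
  interpret prob_space P by fact
  define V where "V m = (\<Sum>j = 1..n. gradient (f m j) xs)" for m
  define B where "B m = (norm (gradient (F m) xs))\<^sup>2 + real N / (4 * real M) * \<sigma>2 m" for m
  define D where "D m p = (\<Sum>i<n. (norm (\<Sum>j<i. gradient (f m (p ! j)) xs))\<^sup>2)" for m and p :: "nat list"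
  define e where "e t \<omega> = (norm (fed_iterate \<gamma> M n f R x0 (\<lambda>t m. \<pi> t m \<omega>) t - xs))\<^sup>2" for t \<omega>
  define d where "d = 1 + 2 * \<gamma> * \<mu> * real n"
  define \<kappa> where "\<kappa> = \<gamma> ^ 3 * Lmax / real M"
  define K where "K = \<gamma>\<^sup>2 * Lmax / (real M * \<mu>) * (\<Sum>m = 1..M. B m)"
  have L_le: "L i \<le> Lmax" if "i \<in> {1..n}" for i using that assms(7) by simp
  have Lmax: "0 < Lmax" using assms(6)[of 1] L_le[of 1] assms(2) by simp
  have d: "d > 1" using assms(2,11,15) by (simp add: d_def)
  have smooth: "L_smooth Lmax (f m i)" if "m \<in> {1..M}" "i \<in> {1..n}" for m i
    using L_smooth_mono[OF assms(5)[OF that] L_le[OF that(2)]] .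
  have F: "F m = (\<lambda>x. \<Sum>j = 1..n. f m j x)" for m using assms(8) by auto
  have gradF: "gradient (F m) xs = V m" if "m \<in> {1..M}" for m
    unfolding F V_def using smooth[OF that] by (intro gradient_eq GDERIV_sum L_smooth_GDERIV) auto
  have mean: "(\<integral>\<omega>. D m (\<pi> t m \<omega>) \<partial>P) \<le> 2 * real n * B m" if "t < T" "m \<in> {1..M}" for t m
  proof -
    have "real N / (4 * real M) = real n / 4" using assms(1,3) by simp
    then have "(\<Sum>p\<in>permutations_of_set {1..n}. D m p) \<le> fact n * (2 * real n * B m)"
      using sum_permutations_shuffling_deviation[OF assms(2), of "\<lambda>j. gradient (f m j) xs"]
      by (simp only: D_def B_def assms(14) gradF[OF that(2)] V_def)
    then show ?thesis
      using uniform_permutation_expectation(2)[OF sampling_uniform_permutation[OF assms(18) that], of "D m"]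
      by (simp add: divide_le_eq mult.commute)
  qed
  \<comment> \<open>This makes \<open>K\<close> the fixed point of the recursion: \<open>K\<close>
    plus the mean noise of one epoch, divided by \<open>d\<close>, is \<open>K\<close>
    again.\<close>
  have \<kappa>K: "\<kappa> * (\<Sum>m = 1..M. 2 * real n * B m) = (d - 1) * K"
    using assms(1,11) unfolding \<kappa>_def K_def d_def sum_distrib_left[symmetric]
    by (simp add: field_simps power2_eq_square power3_eq_cube)
  \<comment> \<open>The sampling assumption fixes only laws: on a null set
    \<open>\<pi> t m \<omega>\<close> may fail to be a permutation.\<close>
  have step: "AE \<omega> in P. e (Suc t) \<omega> \<le> (e t \<omega> + \<kappa> * (\<Sum>m = 1..M. D m (\<pi> t m \<omega>))) / d" if "t < T" for t
  proof -
    have "AE \<omega> in P. \<forall>m\<in>{1..M}. \<pi> t m \<omega> \<in> permutations_of_set {1..n}"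
      by (intro AE_finite_allI uniform_permutation_AE sampling_uniform_permutation[OF assms(18) that]) auto
    then show ?thesis
    proof eventually_elim
      case (elim \<omega>)
      then show ?case
        unfolding e_def D_def \<kappa>_def d_def fed_iterate.simps
        using assms(1,2,4,9-13,15,16) Lmax smooth
        by (intro fed_epoch_dist) (auto simp: F assms(3))
    qed
  qed
  \<comment> \<open>The induction carries an integrable majorant of \<open>e t\<close>, so that
    measurability and integrability are only tracked for sums of the deviations
    \<open>D\<close>.\<close>
  have "\<exists>G. integrable P G \<and> (AE \<omega> in P. e t \<omega> \<le> G \<omega>) \<and> integral\<^sup>L P G \<le> (1 / d) ^ t * (norm (x0 - xs))\<^sup>2 + K"
    if "t \<le> T" for t
    using that
  proof (induction t)
    case 0
    have "0 \<le> K"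
      unfolding K_def B_def assms(14) using assms(11) Lmax
      by (intro mult_nonneg_nonneg sum_nonneg add_nonneg_nonneg) auto
    then show ?case
      by (intro exI[of _ "\<lambda>_. (norm (x0 - xs))\<^sup>2"]) (auto simp: e_def prob_space)
  next
    case (Suc t)
    then obtain G where G: "integrable P G" "AE \<omega> in P. e t \<omega> \<le> G \<omega>"
      "integral\<^sup>L P G \<le> (1 / d) ^ t * (norm (x0 - xs))\<^sup>2 + K" by auto
    have t: "t < T" using Suc.prems by simp
    have int: "integrable P (\<lambda>\<omega>. D m (\<pi> t m \<omega>))" if "m \<in> {1..M}" for m
      by (rule uniform_permutation_expectation(1)[OF sampling_uniform_permutation[OF assms(18) t that]])
    have int_sum: "integrable P (\<lambda>\<omega>. \<Sum>m = 1..M. D m (\<pi> t m \<omega>))"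
      using int by (intro Bochner_Integration.integrable_sum)
    define H where "H \<omega> = (G \<omega> + \<kappa> * (\<Sum>m = 1..M. D m (\<pi> t m \<omega>))) / d" for \<omega>
    have "integrable P H"
      unfolding H_def using G(1) int_sum
      by (intro integrable_divide Bochner_Integration.integrable_add integrable_mult_right)
    moreover have "AE \<omega> in P. e (Suc t) \<omega> \<le> H \<omega>"
      using step[OF t] G(2)
    proof eventually_elim
      case (elim \<omega>)
      have "(e t \<omega> + \<kappa> * (\<Sum>m = 1..M. D m (\<pi> t m \<omega>))) / d \<le> H \<omega>"
        unfolding H_def using elim(2) d by (intro divide_right_mono) auto
      then show ?case using elim(1) by simp
    qed
    moreover have "integral\<^sup>L P H \<le> (1 / d) ^ Suc t * (norm (x0 - xs))\<^sup>2 + K"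
    proof -
      have "integral\<^sup>L P H = (integral\<^sup>L P G + \<kappa> * (\<Sum>m = 1..M. \<integral>\<omega>. D m (\<pi> t m \<omega>) \<partial>P)) / d"
        unfolding H_def
        using G(1) int_sum Bochner_Integration.integral_sum[of "{1..M}" P, OF int] by simp
      also have "\<dots> \<le> ((1 / d) ^ t * (norm (x0 - xs))\<^sup>2 + K + \<kappa> * (\<Sum>m = 1..M. 2 * real n * B m)) / d"
        using d Lmax assms(15) G(3) mean[OF t] unfolding \<kappa>_def
        by (intro divide_right_mono add_mono mult_left_mono sum_mono) auto
      also have "\<dots> = (1 / d) ^ Suc t * (norm (x0 - xs))\<^sup>2 + K"
        unfolding \<kappa>K using d by (simp add: field_simps)
      finally show ?thesis .
    qed
    ultimately show ?case by blast
  qed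
  then obtain G where G: "integrable P G" "AE \<omega> in P. e T \<omega> \<le> G \<omega>"
    "integral\<^sup>L P G \<le> (1 / d) ^ T * (norm (x0 - xs))\<^sup>2 + K" by blast
  \<comment> \<open>A non-integrable function has integral 0 by convention; nonnegativity of the
    majorant covers this case in the final comparison.\<close>
  from G(2) have "AE \<omega> in P. 0 \<le> G \<omega>"
  proof eventually_elim
    case (elim \<omega>)
    moreover have "0 \<le> e T \<omega>" by (simp add: e_def)
    ultimately show ?case by simp
  qed
  then have "(\<integral>\<omega>. e T \<omega> \<partial>P) \<le> (1 / d) ^ T * (norm (x0 - xs))\<^sup>2 + K"
    using integral_mono_AE'[OF G(1,2)] G(3) by linarith
  then show ?thesis
    unfolding e_def K_def B_def d_def by (simp add: power_int_minus power_one_over inverse_eq_divide)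
qed

end
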